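(* Let $G$ be any finite graph, let $|G|$ denote the number of edges of $G$, and let $\delta$ be a variable. Let $M_G$ be the graph evaluation determined by the recursion $M_G = 2M_{G/e}-M_{G-e}$ for each edge $e$, with value $\delta^k$ on the graph with $k$ nodes and no edges. Then $$M_G = (-1)^{|G|}\,Z_G(\delta, v=-2) = \sum_{H}(-1)^{|H|}\,C(G/H^c)(\delta),$$ where $H$ runs over all subgraphs of $G$ given by subsets of the edge set of $G$, $|H|$ is the number of edges of $H$, $H^c$ is the complementary set of edges, and $G/H^c$ is the result of contracting all the edges of $H^c$ in $G$.
   Context: Graphs are finite and may have loops and multiple edges. $G-e$ denotes deletion of the edge $e$ and $G/e$ denotes contraction of $e$ (the edge is removed and its end nodes are identified; contracting a loop means removing it). $Z_G=Z_G(\delta,v)$ is the dichromatic polynomial, determined by $Z_G = Z_{G-e}+v\,Z_{G/e}$ for each edge $e$, and $Z_{G\cup\bullet}=\delta Z_G$, where $\bullet$ is a node disjoint from the rest of the graph (with value $1$ on the empty graph, so that the graph with $k$ nodes and no edges has value $\delta^k$). $C(G)(\delta)$ is the chromatic polynomial of $G$ in the variable $\delta$, determined by $C(G)=C(G-e)-C(G/e)$ for each edge $e$ and value $\delta^k$ on the graph with $k$ nodes and no edges (so $C(G)=0$ if $G$ has a loop). *)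

theory Defs
  imports "HOL-Library.Uprod" "HOL-Computational_Algebra.Polynomial"
begin

section \<open>Finite graphs with loops and multiple edges\<close>

text \<open>
  A graph consists of a finite set of nodes of type \<open>'v\<close> and a finite set of labelled edges of
  type \<open>'e\<close>, each edge being sent to the unordered pair of its end nodes; \<open>Upair x x\<close> is a loop.
  The edge set is the domain of the incidence map, so equality of graphs is literal equality of
  nodes, edges and incidences.
\<close>

typedef ('v, 'e) mgraph =
  "{(V :: 'v set, I :: 'e \<Rightarrow> 'v uprod option).
      finite V \<and> finite (dom I) \<and> (\<forall>p \<in> ran I. set_uprod p \<subseteq> V)}"
  by (rule exI[of _ "({}, Map.empty)"]) simp

definition nodes :: "('v, 'e) mgraph \<Rightarrow> 'v set"
  where "nodes G = fst (Rep_mgraph G)"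

definition ends :: "('v, 'e) mgraph \<Rightarrow> 'e \<Rightarrow> 'v uprod option"
  where "ends G = snd (Rep_mgraph G)"

definition edges :: "('v, 'e) mgraph \<Rightarrow> 'e set"
  where "edges G = dom (ends G)"

definition empty_graph :: "('v, 'e) mgraph"
  where "empty_graph = Abs_mgraph ({}, Map.empty)"

definition add_node :: "'v \<Rightarrow> ('v, 'e) mgraph \<Rightarrow> ('v, 'e) mgraph"
  where "add_node x G = Abs_mgraph (insert x (nodes G), ends G)"

definition delete_edge :: "('v, 'e) mgraph \<Rightarrow> 'e \<Rightarrow> ('v, 'e) mgraph"
  where "delete_edge G e = Abs_mgraph (nodes G, (ends G)(e := None))"

text \<open>
  Contracting a set \<open>A\<close> of edges removes the edges in \<open>A\<close> and identifies any two nodes joined by a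
  path of edges in \<open>A\<close>. To stay within the node type \<open>'v\<close>, a class of identified nodes is
  represented by one of its members.
\<close>

definition joined :: "('v, 'e) mgraph \<Rightarrow> 'e set \<Rightarrow> ('v \<times> 'v) set"
  where "joined G A = {(x, y). \<exists>e\<in>A. ends G e = Some (Upair x y)}\<^sup>*"

definition class_rep :: "('v, 'e) mgraph \<Rightarrow> 'e set \<Rightarrow> 'v \<Rightarrow> 'v"
  where "class_rep G A x = (SOME y. (x, y) \<in> joined G A)"

definition contract_edges :: "('v, 'e) mgraph \<Rightarrow> 'e set \<Rightarrow> ('v, 'e) mgraph"
  where "contract_edges G A = Abs_mgraph
    (class_rep G A ` nodes G,
     \<lambda>e. if e \<in> A then None else map_option (map_uprod (class_rep G A)) (ends G e))"

definition contract_edge :: "('v, 'e) mgraph \<Rightarrow> 'e \<Rightarrow> ('v, 'e) mgraph"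
  where "contract_edge G e = contract_edges G {e}"

section \<open>The graph evaluations\<close>

text \<open>
  Each evaluation is the unique function satisfying its defining rules; existence and uniqueness
  are proved below. Elements of \<^typ>\<open>int poly\<close> are polynomials in \<open>\<delta>\<close>. Elements of
  \<^typ>\<open>int poly poly\<close> are polynomials in \<open>v\<close> with coefficients in \<open>\<int>[\<delta>]\<close>, so that
  \<^term>\<open>poly p (-2) :: int poly\<close> is the specialisation \<open>v = -2\<close>.
\<close>

definition is_dichromatic :: "(('v, 'e) mgraph \<Rightarrow> int poly poly) \<Rightarrow> bool"
  where "is_dichromatic Z \<longleftrightarrow>
    (\<forall>G. \<forall>e \<in> edges G. Z G = Z (delete_edge G e) + [:0, 1:] * Z (contract_edge G e)) \<and>
    (\<forall>G. \<forall>x. x \<notin> nodes G \<longrightarrow> Z (add_node x G) = [:[:0, 1:]:] * Z G) \<and>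
    Z empty_graph = 1"

definition dichromatic :: "('v, 'e) mgraph \<Rightarrow> int poly poly"
  where "dichromatic = (THE Z. is_dichromatic Z)"

definition is_chromatic :: "(('v, 'e) mgraph \<Rightarrow> int poly) \<Rightarrow> bool"
  where "is_chromatic C \<longleftrightarrow>
    (\<forall>G. \<forall>e \<in> edges G. C G = C (delete_edge G e) - C (contract_edge G e)) \<and>
    (\<forall>G. edges G = {} \<longrightarrow> C G = [:0, 1:] ^ card (nodes G))"

definition chromatic :: "('v, 'e) mgraph \<Rightarrow> int poly"
  where "chromatic = (THE C. is_chromatic C)"

definition is_M_evaluation :: "(('v, 'e) mgraph \<Rightarrow> int poly) \<Rightarrow> bool"
  where "is_M_evaluation M \<longleftrightarrow>
    (\<forall>G. \<forall>e \<in> edges G. M G = 2 * M (contract_edge G e) - M (delete_edge G e)) \<and>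
    (\<forall>G. edges G = {} \<longrightarrow> M G = [:0, 1:] ^ card (nodes G))"

definition M_evaluation :: "('v, 'e) mgraph \<Rightarrow> int poly"
  where "M_evaluation = (THE M. is_M_evaluation M)"

section \<open>Existence and uniqueness of the evaluations\<close>

lemma Rep_mgraph_pair: "Rep_mgraph G = (nodes G, ends G)"
  by (simp add: nodes_def ends_def)

lemma mgraph_eqI: "nodes G = nodes H \<Longrightarrow> ends G = ends H \<Longrightarrow> G = H"
  by (metis Rep_mgraph_inject Rep_mgraph_pair)

lemma finite_nodes [simp]: "finite (nodes G)"
  and finite_edges [simp]: "finite (edges G)"
  and ends_subset: "ends G e = Some p \<Longrightarrow> set_uprod p \<subseteq> nodes G"
  using Rep_mgraph[of G] by (auto simp: Rep_mgraph_pair edges_def ran_def)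

lemma
  assumes "finite V" "finite (dom I)" "\<And>e p. I e = Some p \<Longrightarrow> set_uprod p \<subseteq> V"
  shows nodes_Abs: "nodes (Abs_mgraph (V, I)) = V"
    and ends_Abs: "ends (Abs_mgraph (V, I)) = I"
proof -
  have "Rep_mgraph (Abs_mgraph (V, I)) = (V, I)"
    by (rule Abs_mgraph_inverse) (use assms in \<open>auto simp: ran_def\<close>)
  then show "nodes (Abs_mgraph (V, I)) = V" "ends (Abs_mgraph (V, I)) = I"
    by (simp_all add: nodes_def ends_def)
qed

lemma finite_dom_ends [simp]: "finite (dom (ends G))"
  using finite_edges[of G] by (simp add: edges_def)

lemma nodes_empty_graph [simp]: "nodes empty_graph = {}"
  and ends_empty_graph [simp]: "ends empty_graph = Map.empty"
  unfolding empty_graph_def by (subst nodes_Abs ends_Abs; simp)+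

lemma nodes_add_node [simp]: "nodes (add_node x G) = insert x (nodes G)"
  and ends_add_node [simp]: "ends (add_node x G) = ends G"
  unfolding add_node_def by (subst nodes_Abs ends_Abs; use ends_subset in fastforce)+

lemma nodes_delete_edge [simp]: "nodes (delete_edge G e) = nodes G"
  and ends_delete_edge [simp]: "ends (delete_edge G e) = (ends G)(e := None)"
  unfolding delete_edge_def
  by (subst nodes_Abs ends_Abs; use ends_subset in \<open>fastforce split: if_splits\<close>)+

lemma
  shows nodes_contract_edges [simp]: "nodes (contract_edges G A) = class_rep G A ` nodes G"
    and ends_contract_edges [simp]: "ends (contract_edges G A) =
      (\<lambda>e. if e \<in> A then None else map_option (map_uprod (class_rep G A)) (ends G e))"
proof -
  let ?I = "\<lambda>e. if e \<in> A then None else map_option (map_uprod (class_rep G A)) (ends G e)"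
  have 1: "finite (class_rep G A ` nodes G)" by simp
  have 2: "finite (dom ?I)"
    by (rule finite_subset[of _ "dom (ends G)"]) (auto split: if_splits)
  have 3: "set_uprod p \<subseteq> class_rep G A ` nodes G" if "?I e = Some p" for e p
    using that ends_subset[of G e] by (force split: if_splits simp: uprod.set_map)
  show "nodes (contract_edges G A) = class_rep G A ` nodes G" "ends (contract_edges G A) = ?I"
    unfolding contract_edges_def using nodes_Abs[OF 1 2] ends_Abs[OF 1 2] 3 by blast+
qed

lemma edges_add_node [simp]: "edges (add_node x G) = edges G"
  and edges_delete_edge [simp]: "edges (delete_edge G e) = edges G - {e}"
  and edges_contract_edges [simp]: "edges (contract_edges G A) = edges G - A"
  and edges_empty_graph [simp]: "edges empty_graph = {}"
  by (auto simp: edges_def split: if_splits)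

lemma equiv_joined: "equiv UNIV (joined G A)"
proof -
  have "sym {(x, y). \<exists>e\<in>A. ends G e = Some (Upair x y)}"
    by (rule symI) (clarsimp, metis Upair_inject)
  then show ?thesis
    by (simp add: joined_def equiv_def refl_rtrancl trans_rtrancl sym_rtrancl)
qed

lemma joined_refl: "(x, x) \<in> joined G A"
  and joined_sym: "(x, y) \<in> joined G A \<Longrightarrow> (y, x) \<in> joined G A"
  and joined_trans: "(x, y) \<in> joined G A \<Longrightarrow> (y, z) \<in> joined G A \<Longrightarrow> (x, z) \<in> joined G A"
  using equiv_joined[of G A] by (auto simp: equiv_def refl_on_def dest: symD transD)

lemma joined_class_rep: "(x, class_rep G A x) \<in> joined G A"
  unfolding class_rep_def by (rule someI[of _ x]) (rule joined_refl)

lemma class_rep_eq_iff: "class_rep G A x = class_rep G A y \<longleftrightarrow> (x, y) \<in> joined G A"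
proof
  assume "class_rep G A x = class_rep G A y"
  then show "(x, y) \<in> joined G A"
    by (metis joined_class_rep joined_sym joined_trans)
next
  assume "(x, y) \<in> joined G A"
  then have "(x, z) \<in> joined G A \<longleftrightarrow> (y, z) \<in> joined G A" for z
    by (meson joined_sym joined_trans)
  then show "class_rep G A x = class_rep G A y"
    by (simp add: class_rep_def)
qed

lemma class_rep_empty [simp]: "class_rep G {} x = x"
  using joined_class_rep[of x G "{}"] by (simp add: joined_def)

lemma contract_edge_loop:
  assumes "ends G e = Some (Upair x x)"
  shows "contract_edge G e = delete_edge G e"
proof -
  have "joined G {e} \<subseteq> Id"
    unfolding joined_def using assms by (auto elim: rtrancl_induct)
  then have "class_rep G {e} = id"
    using joined_class_rep[of _ G "{e}"] by fastforce
  then have "class_rep G {e} ` nodes G = nodes G"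
    "map_option (map_uprod (class_rep G {e})) p = p" for p
    by (simp_all add: uprod.map_id0 option.map_id0)
  then show ?thesis
    by (intro mgraph_eqI) (auto simp: contract_edge_def)
qed

lemma card_nodes_contract_insert:
  assumes "e \<notin> A"
  shows "card (nodes (contract_edges (contract_edge G e) A)) =
    card (nodes (contract_edges G (insert e A)))"
proof -
  let ?G = "contract_edge G e" and ?r = "class_rep G {e}"
  let ?S = "{(x, y). \<exists>d\<in>A. ends ?G d = Some (Upair x y)}"
  let ?T = "{(x, y). \<exists>d\<in>insert e A. ends G d = Some (Upair x y)}"
  have sub: "joined G {e} \<subseteq> joined G (insert e A)"
    unfolding joined_def by (rule rtrancl_mono) auto
  have r: "(x, ?r x) \<in> joined G (insert e A)" for x
    using sub joined_class_rep by fast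
  have step: "(p, q) \<in> joined G (insert e A)" if "(p, q) \<in> ?S" for p q
  proof -
    from that obtain d where d: "d \<in> A" "ends ?G d = Some (Upair p q)" by auto
    then obtain u where u: "ends G d = Some u" "map_uprod ?r u = Upair p q"
      using assms by (auto simp: contract_edge_def split: if_splits)
    obtain x y where xy: "u = Upair x y" by (cases u)
    have "(x, y) \<in> joined G (insert e A)" "(y, x) \<in> joined G (insert e A)"
      using d u xy unfolding joined_def by (auto intro!: r_into_rtrancl bexI[of _ d])
    then show ?thesis
      using u xy r by (auto intro: joined_trans joined_sym)
  qed
  have fwd: "(p, q) \<in> joined G (insert e A)" if "(p, q) \<in> joined ?G A" for p q
    using that unfolding joined_def[of ?G]
    by (induction rule: rtrancl_induct) (use step joined_refl joined_trans in fast)+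
  have bstep: "(?r x, ?r y) \<in> joined ?G A" if xy: "(x, y) \<in> ?T" for x y
  proof -
    from xy obtain d where d: "d \<in> insert e A" "ends G d = Some (Upair x y)" by auto
    show ?thesis
    proof (cases "d = e")
      case True
      then have "(x, y) \<in> joined G {e}"
        unfolding joined_def using d by (auto intro: r_into_rtrancl)
      then show ?thesis
        using class_rep_eq_iff[of G "{e}" x y] joined_refl by simp
    next
      case False
      then show ?thesis
        unfolding joined_def using d assms
        by (auto simp: contract_edge_def intro!: r_into_rtrancl bexI[of _ d])
    qed
  qed
  have bwd: "(?r x, ?r y) \<in> joined ?G A" if "(x, y) \<in> joined G (insert e A)" for x y
    using that unfolding joined_def[of G]
    by (induction rule: rtrancl_induct) (use bstep joined_refl joined_trans in fast)+
  have iff: "(?r x, ?r y) \<in> joined ?G A \<longleftrightarrow> (x, y) \<in> joined G (insert e A)" for x y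
    using fwd bwd r by (meson joined_sym joined_trans)
  define f where "f = (\<lambda>x. class_rep ?G A (?r x))"
  define g where "g = class_rep G (insert e A)"
  have fg: "f x = f y \<longleftrightarrow> g x = g y" for x y
    by (simp add: f_def g_def class_rep_eq_iff iff)
  have "g x = (g \<circ> inv f) (f x)" for x
    using fg[of x "inv f (f x)"] by (simp add: f_inv_into_f)
  then have img: "(g \<circ> inv f) ` f ` nodes G = g ` nodes G"
    by (metis (no_types, lifting) image_cong image_image)
  have "inj_on (g \<circ> inv f) (f ` nodes G)"
    by (rule inj_onI) (metis comp_apply fg f_inv_into_f rangeI image_iff)
  then have "card (g ` nodes G) = card (f ` nodes G)"
    using card_image img by metis
  then show ?thesis
    by (simp add: f_def g_def contract_edge_def image_image)
qed

lemma nodes_contract_delete: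
  assumes "e \<notin> A"
  shows "nodes (contract_edges (delete_edge G e) A) = nodes (contract_edges G A)"
proof -
  have "joined (delete_edge G e) A = joined G A"
    using assms unfolding joined_def by (metis (no_types, lifting) ends_delete_edge fun_upd_apply)
  then have "class_rep (delete_edge G e) A = class_rep G A"
    by (simp add: class_rep_def fun_eq_iff)
  then show ?thesis by simp
qed

lemma mgraph_evaluation_exists:
  fixes a b d :: "'a :: comm_ring_1"
  defines "F \<equiv> \<lambda>G :: ('v, 'e) mgraph. \<Sum>A\<in>Pow (edges G).
    a ^ card (edges G - A) * b ^ card A * d ^ card (nodes (contract_edges G A))"
  shows "e \<in> edges G \<Longrightarrow> F G = a * F (delete_edge G e) + b * F (contract_edge G e)"
    and "edges G = {} \<Longrightarrow> F G = d ^ card (nodes G)"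
    and "x \<notin> nodes G \<Longrightarrow> F (add_node x G) = d * F G"
proof -
  assume e: "e \<in> edges G"
  let ?E = "edges G - {e}"
  let ?t = "\<lambda>A. a ^ card (edges G - A) * b ^ card A * d ^ card (nodes (contract_edges G A))"
  have E: "Pow (edges G) = Pow ?E \<union> insert e ` Pow ?E"
    using e Pow_insert[of e ?E] by (simp add: insert_absorb)
  have "F G = sum ?t (Pow ?E) + sum ?t (insert e ` Pow ?E)"
    unfolding F_def E by (rule sum.union_disjoint) auto
  also have "sum ?t (insert e ` Pow ?E) = (\<Sum>A\<in>Pow ?E. ?t (insert e A))"
    by (rule sum.reindex_cong[OF _ refl refl]) (auto simp: inj_on_def)
  also have "\<dots> = b * F (contract_edge G e)"
  proof -
    have "?t (insert e A) = b * (a ^ card (?E - A) * b ^ card A *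
        d ^ card (nodes (contract_edges (contract_edge G e) A)))" if "A \<in> Pow ?E" for A
    proof -
      have "e \<notin> A" "finite A" using that by (auto intro: finite_subset[OF _ finite_edges])
      moreover have "edges G - insert e A = ?E - A" by auto
      ultimately show ?thesis
        by (simp add: card_nodes_contract_insert del: nodes_contract_edges)
    qed
    then show ?thesis
      by (simp add: F_def sum_distrib_left contract_edge_def)
  qed
  also have "sum ?t (Pow ?E) = a * F (delete_edge G e)"
  proof -
    have "?t A = a * (a ^ card (?E - A) * b ^ card A *
        d ^ card (nodes (contract_edges (delete_edge G e) A)))" if "A \<in> Pow ?E" for A
    proof -
      have "e \<notin> A" using that by auto
      moreover have "edges G - A = insert e (?E - A)" using e that by auto
      then have "card (edges G - A) = Suc (card (?E - A))" by simp
      ultimately show ?thesis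
        by (simp add: nodes_contract_delete del: nodes_contract_edges)
    qed
    then show ?thesis
      by (simp add: F_def sum_distrib_left)
  qed
  finally show "F G = a * F (delete_edge G e) + b * F (contract_edge G e)" .
next
  assume "edges G = {}"
  then show "F G = d ^ card (nodes G)" by (simp add: F_def)
next
  assume x: "x \<notin> nodes G"
  have "card (nodes (contract_edges (add_node x G) A)) =
      Suc (card (nodes (contract_edges G A)))" for A
  proof -
    let ?R = "{(x, y). \<exists>e\<in>A. ends G e = Some (Upair x y)}"
    have eq: "joined (add_node x G) A = joined G A" by (simp add: joined_def)
    have R: "q \<in> nodes G" if "(p, q) \<in> ?R" for p q
      using that by (auto dest: ends_subset)
    have "(y, x) \<notin> joined G A" if "y \<in> nodes G" for y
      unfolding joined_def using that x R
      by (metis (no_types, lifting) rtranclE)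
    then have "class_rep G A x \<notin> class_rep G A ` nodes G"
      by (metis class_rep_eq_iff imageE joined_sym)
    moreover have "class_rep (add_node x G) A = class_rep G A"
      by (simp add: class_rep_def eq fun_eq_iff)
    ultimately show ?thesis by simp
  qed
  then show "F (add_node x G) = d * F G"
    by (simp add: F_def sum_distrib_left mult_ac del: nodes_contract_edges)
qed

lemma mgraph_evaluation_obtain:
  fixes a b d :: "'a :: comm_ring_1"
  obtains F :: "('v, 'e) mgraph \<Rightarrow> 'a"
  where "\<And>G e. e \<in> edges G \<Longrightarrow> F G = a * F (delete_edge G e) + b * F (contract_edge G e)"
    and "\<And>G. edges G = {} \<Longrightarrow> F G = d ^ card (nodes G)"
    and "\<And>G x. x \<notin> nodes G \<Longrightarrow> F (add_node x G) = d * F G"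
  using mgraph_evaluation_exists[where ?'v = 'v and ?'e = 'e and a = a and b = b and d = d]
  by (rule that)

lemma mgraph_evaluation_unique:
  fixes F F' :: "('v, 'e) mgraph \<Rightarrow> 'a :: comm_ring_1"
  assumes "\<And>G e. e \<in> edges G \<Longrightarrow> F G = a * F (delete_edge G e) + b * F (contract_edge G e)"
    and "\<And>G e. e \<in> edges G \<Longrightarrow> F' G = a * F' (delete_edge G e) + b * F' (contract_edge G e)"
    and "\<And>G. edges G = {} \<Longrightarrow> F G = F' G"
  shows "F = F'"
proof
  show "F G = F' G" for G
  proof (induction "card (edges G)" arbitrary: G rule: less_induct)
    case less
    show ?case
    proof (cases "edges G = {}")
      case False
      then obtain e where e: "e \<in> edges G" by auto
      then have "card (edges G - {e}) < card (edges G)"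
        by (intro card_Diff1_less) simp_all
      then have "F (delete_edge G e) = F' (delete_edge G e)"
        "F (contract_edge G e) = F' (contract_edge G e)"
        using less by (simp_all add: contract_edge_def)
      then show ?thesis using assms(1,2) e by metis
    qed (rule assms(3))
  qed
qed

lemma evaluation_edgeless:
  fixes F :: "('v, 'e) mgraph \<Rightarrow> 'a :: comm_ring_1"
  assumes "\<And>G x. x \<notin> nodes G \<Longrightarrow> F (add_node x G) = d * F G" "F empty_graph = 1"
    and "edges G = {}"
  shows "F G = d ^ card (nodes G)"
proof -
  have "\<forall>G. nodes G = V \<longrightarrow> edges G = {} \<longrightarrow> F G = d ^ card V" if "finite V" for V
    using that
  proof (induction V)
    case empty
    have "G = empty_graph" if "nodes G = {}" "edges G = {}" for G :: "('v, 'e) mgraph"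
      using that by (intro mgraph_eqI) (auto simp: edges_def)
    then show ?case using assms(2) by auto
  next
    case (insert x V)
    show ?case
    proof (intro allI impI)
      fix G :: "('v, 'e) mgraph" assume G: "nodes G = insert x V" "edges G = {}"
      define H :: "('v, 'e) mgraph" where "H = Abs_mgraph (V, Map.empty)"
      have H: "nodes H = V" "ends H = Map.empty"
        unfolding H_def using insert nodes_Abs[of V Map.empty] ends_Abs[of V Map.empty]
        by simp_all
      have "G = add_node x H"
        using G H by (intro mgraph_eqI) (auto simp: edges_def)
      then show "F G = d ^ card (insert x V)"
        using insert H assms(1)[of x H] by (simp add: edges_def)
    qed
  qed
  then show ?thesis using assms(3) by simp
qed

lemma ex1_dichromatic: "\<exists>!Z :: ('v, 'e) mgraph \<Rightarrow> int poly poly. is_dichromatic Z"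
proof (rule ex_ex1I)
  obtain F :: "('v, 'e) mgraph \<Rightarrow> int poly poly" where
    "\<And>G e. e \<in> edges G \<Longrightarrow> F G = 1 * F (delete_edge G e) + [:0, 1:] * F (contract_edge G e)"
    "\<And>G. edges G = {} \<Longrightarrow> F G = [:[:0, 1:]:] ^ card (nodes G)"
    "\<And>G x. x \<notin> nodes G \<Longrightarrow> F (add_node x G) = [:[:0, 1:]:] * F G"
    by (rule mgraph_evaluation_obtain) blast
  then have "is_dichromatic F"
    by (simp add: is_dichromatic_def)
  then show "\<exists>Z :: ('v, 'e) mgraph \<Rightarrow> int poly poly. is_dichromatic Z" by blast
next
  fix Z Z' :: "('v, 'e) mgraph \<Rightarrow> int poly poly"
  assume Z: "is_dichromatic Z" "is_dichromatic Z'"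
  show "Z = Z'"
  proof (rule mgraph_evaluation_unique[where a = 1 and b = "[:0, 1:]"])
    show "Z G = Z' G" if "edges G = {}" for G
      using evaluation_edgeless[of Z _ G] evaluation_edgeless[of Z' _ G] that Z
      unfolding is_dichromatic_def by metis
  qed (use Z in \<open>auto simp: is_dichromatic_def\<close>)
qed

lemma ex1_chromatic: "\<exists>!C :: ('v, 'e) mgraph \<Rightarrow> int poly. is_chromatic C"
proof (rule ex_ex1I)
  obtain F :: "('v, 'e) mgraph \<Rightarrow> int poly" where
    "\<And>G e. e \<in> edges G \<Longrightarrow> F G = 1 * F (delete_edge G e) + (-1) * F (contract_edge G e)"
    "\<And>G. edges G = {} \<Longrightarrow> F G = [:0, 1:] ^ card (nodes G)"
    "\<And>G x. x \<notin> nodes G \<Longrightarrow> F (add_node x G) = [:0, 1:] * F G"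
    by (rule mgraph_evaluation_obtain) blast
  then have "is_chromatic F"
    by (simp add: is_chromatic_def)
  then show "\<exists>C :: ('v, 'e) mgraph \<Rightarrow> int poly. is_chromatic C" by blast
next
  fix C C' :: "('v, 'e) mgraph \<Rightarrow> int poly"
  assume "is_chromatic C" "is_chromatic C'"
  then show "C = C'"
    by (intro mgraph_evaluation_unique[where a = 1 and b = "-1"]) (auto simp: is_chromatic_def)
qed

lemma ex1_M_evaluation: "\<exists>!M :: ('v, 'e) mgraph \<Rightarrow> int poly. is_M_evaluation M"
proof (rule ex_ex1I)
  obtain F :: "('v, 'e) mgraph \<Rightarrow> int poly" where
    "\<And>G e. e \<in> edges G \<Longrightarrow> F G = (-1) * F (delete_edge G e) + 2 * F (contract_edge G e)"
    "\<And>G. edges G = {} \<Longrightarrow> F G = [:0, 1:] ^ card (nodes G)"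
    "\<And>G x. x \<notin> nodes G \<Longrightarrow> F (add_node x G) = [:0, 1:] * F G"
    by (rule mgraph_evaluation_obtain) blast
  then have "is_M_evaluation F"
    by (simp add: is_M_evaluation_def)
  then show "\<exists>M :: ('v, 'e) mgraph \<Rightarrow> int poly. is_M_evaluation M" by blast
next
  fix M M' :: "('v, 'e) mgraph \<Rightarrow> int poly"
  assume "is_M_evaluation M" "is_M_evaluation M'"
  then show "M = M'"
    by (intro mgraph_evaluation_unique[where a = "-1" and b = 2])
       (auto simp: is_M_evaluation_def)
qed

lemma is_dichromatic_dichromatic: "is_dichromatic dichromatic"
  unfolding dichromatic_def by (rule theI'[OF ex1_dichromatic])

lemma is_chromatic_chromatic: "is_chromatic chromatic"
  unfolding chromatic_def by (rule theI'[OF ex1_chromatic])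

lemma is_M_evaluation_M_evaluation: "is_M_evaluation M_evaluation"
  unfolding M_evaluation_def by (rule theI'[OF ex1_M_evaluation])

end

(* Each of these evaluations is a state sum: F(G) = a F(G - e) + b F(G/e) with edgeless values
   \<delta>^k gives F(G) = \<Sum>A. a^|A^c| b^|A| \<delta>^k(A), where k(A) is the number of
   components of the spanning subgraph A. Since contracting H^c and then A amounts to contracting
   B = A \<union> H^c, the sum over H is a double sum over pairs A \<subseteq> H. The pair has sign
   (-1)^|B^c|, and each B arises from 2^|B| pairs, one for each A \<subseteq> B; this is the state
   sum of M. *)
theory Submission
  imports Defs
begin

text \<open>Representatives are picked by \<open>SOME\<close>, so node sets of different
  contractions can only be compared through the partitions that their representative maps
  induce.\<close>

lemma card_image_eq_same_kernel:
  assumes "\<And>x y. x \<in> V \<Longrightarrow> y \<in> V \<Longrightarrow> f x = f y \<longleftrightarrow> g x = g y"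
  shows "card (f ` V) = card (g ` V)"
proof -
  let ?h = "g \<circ> inv_into V f"
  \<comment> \<open>Any preimage of \<open>f x\<close> in \<open>V\<close> has the same
    \<open>g\<close>-value as \<open>x\<close>, so the choice made by \<open>inv_into\<close> is
    harmless.\<close>
  have h: "?h (f x) = g x" if "x \<in> V" for x
    using that assms[of "inv_into V f (f x)" x] by (simp add: f_inv_into_f inv_into_into)
  have "inj_on ?h (f ` V)"
    using h assms by (auto simp: inj_on_def)
  moreover have "?h ` f ` V = g ` V"
    using h by (force simp: image_image)
  ultimately show ?thesis
    by (metis card_image)
qed

lemma joined_mono: "A \<subseteq> B \<Longrightarrow> joined G A \<subseteq> joined G B"
  unfolding joined_def by (rule rtrancl_mono) auto

lemma joined_edge: "e \<in> A \<Longrightarrow> ends G e = Some (Upair x y) \<Longrightarrow> (x, y) \<in> joined G A"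
  unfolding joined_def by (rule r_into_rtrancl) auto

text \<open>Every node is \<open>B\<close>-joined to its representative, so a path in the contracted
  graph lifts to \<open>A \<union> B\<close>; conversely a path in \<open>A \<union> B\<close>
  projects edge by edge. \<open>A\<close> and \<open>B\<close> may overlap.\<close>

lemma joined_contract_edges_iff:
  "(class_rep G B x, class_rep G B y) \<in> joined (contract_edges G B) A \<longleftrightarrow>
    (x, y) \<in> joined G (A \<union> B)"
proof
  let ?G = "contract_edges G B" and ?r = "class_rep G B"
  have r: "(z, ?r z) \<in> joined G (A \<union> B)" for z
    using joined_class_rep joined_mono[of B "A \<union> B"] by fast
  have edge: "(p, q) \<in> joined G (A \<union> B)"
    if d: "d \<in> A" "ends ?G d = Some (Upair p q)" for p q d
  proof -
    obtain e where e: "ends G d = Some e" "map_uprod ?r e = Upair p q"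
      using d(2) by (auto split: if_splits)
    obtain u v where "e = Upair u v" by (cases e)
    with e have uv: "ends G d = Some (Upair u v)" "Upair (?r u) (?r v) = Upair p q"
      by simp_all
    have "(u, v) \<in> joined G (A \<union> B)"
      using d uv by (blast intro: joined_edge)
    then have "(?r u, ?r v) \<in> joined G (A \<union> B)"
      using r by (meson joined_sym joined_trans)
    then show ?thesis
      \<comment> \<open>Equality of unordered pairs fixes \<open>(p, q)\<close> only up to a
        swap.\<close>
      using uv(2) joined_sym[of "?r u" "?r v"] by auto
  qed
  have "(p, q) \<in> joined G (A \<union> B)" if "(p, q) \<in> joined ?G A" for p q
    using that unfolding joined_def[of ?G]
  proof (induction rule: rtrancl_induct)
    case (step y z)
    then show ?case by (auto intro: joined_trans[OF _ edge])
  qed (rule joined_refl)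
  then show "(x, y) \<in> joined G (A \<union> B)" if "(?r x, ?r y) \<in> joined ?G A"
    using that r by (meson joined_sym joined_trans)
next
  let ?G = "contract_edges G B" and ?r = "class_rep G B"
  have edge: "(?r u, ?r v) \<in> joined ?G A"
    if d: "d \<in> A \<union> B" "ends G d = Some (Upair u v)" for u v d
  proof (cases "d \<in> B")
    \<comment> \<open>An edge of \<open>B\<close> collapses to a single node, so its image is a
      trivial path.\<close>
    case True
    then show ?thesis
      using d joined_edge[of d B G u v] class_rep_eq_iff[of G B u v] joined_refl by simp
  next
    case False
    then show ?thesis
      using d by (auto intro!: joined_edge[of d])
  qed
  assume "(x, y) \<in> joined G (A \<union> B)"
  then show "(?r x, ?r y) \<in> joined ?G A"
    unfolding joined_def[of G]
  proof (induction rule: rtrancl_induct)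
    case (step y z)
    then show ?case by (auto intro: joined_trans[OF _ edge])
  qed (rule joined_refl)
qed

lemma card_nodes_contract_contract:
  "card (nodes (contract_edges (contract_edges G B) A)) = card (nodes (contract_edges G (A \<union> B)))"
  unfolding nodes_contract_edges image_image
  by (rule card_image_eq_same_kernel) (simp add: class_rep_eq_iff joined_contract_edges_iff)

text \<open>The subset sum obeys the same recursion. On an edgeless graph only the empty subset
  remains, and contracting it changes no nodes, so uniqueness applies.\<close>

lemma evaluation_state_sum:
  fixes F :: "('v, 'e) mgraph \<Rightarrow> 'a :: comm_ring_1"
  assumes "\<And>G e. e \<in> edges G \<Longrightarrow> F G = a * F (delete_edge G e) + b * F (contract_edge G e)"
    and "\<And>G. edges G = {} \<Longrightarrow> F G = d ^ card (nodes G)"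
  shows "F G = (\<Sum>A\<in>Pow (edges G).
    a ^ card (edges G - A) * b ^ card A * d ^ card (nodes (contract_edges G A)))"
proof -
  let ?S = "\<lambda>G :: ('v, 'e) mgraph. \<Sum>A\<in>Pow (edges G).
    a ^ card (edges G - A) * b ^ card A * d ^ card (nodes (contract_edges G A))"
  have "F = ?S"
    by (rule mgraph_evaluation_unique[OF assms(1) mgraph_evaluation_exists(1)])
       (auto simp: assms(2))
  then show ?thesis by (rule fun_cong)
qed

lemma M_evaluation_state_sum:
  "M_evaluation G = (\<Sum>A\<in>Pow (edges G).
    (-1) ^ card (edges G - A) * 2 ^ card A * [:0, 1:] ^ card (nodes (contract_edges G A)))"
  by (rule evaluation_state_sum)
     (use is_M_evaluation_M_evaluation in \<open>auto simp: is_M_evaluation_def\<close>)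

text \<open>Whitney's subgraph expansion, the case \<open>a = 1\<close>,
  \<open>b = -1\<close>.\<close>

lemma chromatic_state_sum:
  "chromatic G = (\<Sum>A\<in>Pow (edges G). (-1) ^ card A * [:0, 1:] ^ card (nodes (contract_edges G A)))"
proof -
  have "chromatic G = (\<Sum>A\<in>Pow (edges G).
      1 ^ card (edges G - A) * (-1) ^ card A * [:0, 1:] ^ card (nodes (contract_edges G A)))"
    by (rule evaluation_state_sum)
       (use is_chromatic_chromatic in \<open>auto simp: is_chromatic_def\<close>)
  then show ?thesis by simp
qed

text \<open>Deletion and contraction each lose exactly one edge, so the sign factor turns the
  coefficients 1 and -2 of Z at v = -2 into -1 and 2, those of M.\<close>

lemma M_evaluation_eq_dichromatic:
  "M_evaluation G = (-1) ^ card (edges G) * poly (dichromatic G) (-2)"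
proof -
  let ?F = "\<lambda>G :: ('a, 'b) mgraph. (-1) ^ card (edges G) * poly (dichromatic G) (-2)"
  have Z: "is_dichromatic (dichromatic :: ('a, 'b) mgraph \<Rightarrow> _)"
    by (rule is_dichromatic_dichromatic)
  have M: "is_M_evaluation (M_evaluation :: ('a, 'b) mgraph \<Rightarrow> _)"
    by (rule is_M_evaluation_M_evaluation)
  have "M_evaluation = ?F"
  proof (rule mgraph_evaluation_unique[where a = "-1" and b = 2])
    fix G :: "('a, 'b) mgraph" and e
    assume e: "e \<in> edges G"
    then have "dichromatic G =
        dichromatic (delete_edge G e) + [:0, 1:] * dichromatic (contract_edge G e)"
      using Z by (simp add: is_dichromatic_def)
    moreover have "card (edges G) = Suc (card (edges G - {e}))"
      using e by (simp only: card_Suc_Diff1 finite_edges)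
    ultimately show "?F G = -1 * ?F (delete_edge G e) + 2 * ?F (contract_edge G e)"
      by (simp add: contract_edge_def algebra_simps)
  next
    fix G :: "('a, 'b) mgraph"
    assume "edges G = {}"
    moreover from this have "dichromatic G = [:[:0, 1:]:] ^ card (nodes G)"
      using Z by (intro evaluation_edgeless) (auto simp: is_dichromatic_def)
    ultimately show "M_evaluation G = ?F G"
      using M by (simp add: is_M_evaluation_def poly_power)
  qed (use M in \<open>auto simp: is_M_evaluation_def\<close>)
  then show ?thesis by (rule fun_cong)
qed

lemma M_evaluation_eq_chromatic_sum:
  "M_evaluation G =
    (\<Sum>H\<in>Pow (edges G). (-1) ^ card H * chromatic (contract_edges G (edges G - H)))"
proof -
  let ?E = "edges G"
  let ?w = "\<lambda>B. [:0, 1:] ^ card (nodes (contract_edges G B)) :: int poly"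
  have fin: "finite A" if "A \<subseteq> ?E" for A
    using that by (rule finite_subset) simp
  \<comment> \<open>The complement of \<open>A \<union> (?E - H)\<close> is \<open>H - A\<close>,
    and |H| + |A| = |H - A| + 2|A| has the parity of |H - A|.\<close>
  have sign: "(-1) ^ card H * (-1) ^ card A = ((-1) ^ card (?E - (A \<union> (?E - H))) :: int poly)"
    if "A \<subseteq> H" "H \<subseteq> ?E" for A H
  proof -
    have "?E - (A \<union> (?E - H)) = H - A" using that by auto
    moreover have "card H = card (H - A) + card A"
      using that fin card_Un_disjoint[of "H - A" A]
      by (metis Diff_disjoint Int_commute Un_Diff_cancel2 finite_Diff order_trans sup.absorb1)
    ultimately show ?thesis
      by (simp add: power_add flip: power_mult_distrib)
  qed
  have "(\<Sum>H\<in>Pow ?E. (-1) ^ card H * chromatic (contract_edges G (?E - H))) =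
      (\<Sum>H\<in>Pow ?E. \<Sum>A\<in>Pow H. (-1) ^ card H * (-1) ^ card A * ?w (A \<union> (?E - H)))"
  proof (rule sum.cong[OF refl])
    fix H assume "H \<in> Pow ?E"
    \<comment> \<open>The edges left after the contraction are those of \<open>H\<close>, so the
      chromatic state sum runs over \<open>Pow H\<close>.\<close>
    then have "?E - (?E - H) = H" by auto
    then show "(-1) ^ card H * chromatic (contract_edges G (?E - H)) =
        (\<Sum>A\<in>Pow H. (-1) ^ card H * (-1) ^ card A * ?w (A \<union> (?E - H)))"
      by (simp add: chromatic_state_sum card_nodes_contract_contract sum_distrib_left mult.assoc
          del: nodes_contract_edges)
  qed
  also have "\<dots> = (\<Sum>(H, A)\<in>Sigma (Pow ?E) Pow. (-1) ^ card H * (-1) ^ card A * ?w (A \<union> (?E - H)))"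
    by (rule sum.Sigma) (auto intro: fin)
  \<comment> \<open>Since \<open>A \<subseteq> H\<close>, the union B of \<open>A\<close> and
    \<open>?E - H\<close> is disjoint; hence \<open>B - A\<close> recovers \<open>?E - H\<close>,
    which gives the inverse map.\<close>
  also have "\<dots> = (\<Sum>(B, A)\<in>Sigma (Pow ?E) Pow. (-1) ^ card (?E - B) * ?w B)"
    by (rule sum.reindex_bij_witness[where i = "\<lambda>(B, A). (?E - (B - A), A)"
          and j = "\<lambda>(H, A). (A \<union> (?E - H), A)"])
       (auto simp: sign simp del: nodes_contract_edges)
  also have "\<dots> = (\<Sum>B\<in>Pow ?E. \<Sum>A\<in>Pow B. (-1) ^ card (?E - B) * ?w B)"
    by (rule sum.Sigma[symmetric]) (auto intro: fin)
  \<comment> \<open>The summand is constant in \<open>A\<close>, so the inner sum contributes the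
    factor \<open>2 ^ card B\<close>.\<close>
  also have "\<dots> = M_evaluation G"
    by (auto simp: M_evaluation_state_sum card_Pow fin mult_ac simp del: nodes_contract_edges
        intro!: sum.cong)
  finally show ?thesis ..
qed

theorem mainTheorem2:
  fixes G :: "('v, 'e) mgraph"
  shows "M_evaluation G = (-1) ^ card (edges G) * poly (dichromatic G) (-2) \<and>
    (-1) ^ card (edges G) * poly (dichromatic G) (-2) =
      (\<Sum>H \<in> Pow (edges G). (-1) ^ card H * chromatic (contract_edges G (edges G - H)))"
  using M_evaluation_eq_dichromatic[of G] M_evaluation_eq_chromatic_sum[of G] by presburger

end
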